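(* For every finite field $\mathbf{F}_q$ of characteristic $p$, every $e\geq 1$, and every $n\geq 2$, the map $$F_{q,e,n}(X_1,\ldots,X_n)=\left(X_1+\bigl(X_2(X_1^q-X_1)\bigr)^{p^e},X_2,\ldots,X_n\right)$$ is a mock automorphism over $\mathbf{F}_q$ with $$\mathcal{S}_q(F_{q,e,n})=\{1\}.$$ For every perfect field $L$ properly containing $\mathbf{F}_q$, the induced map $F_{q,e,n}\colon L^n\to L^n$ is noninjective.
   Context: A polynomial map $F\in\mathbf{F}_q[X_1,\ldots,X_n]^n$ is a Keller map if the determinant of its Jacobian matrix is a nonzero constant; it is a mock automorphism over $\mathbf{F}_q$ if it is a Keller map and the induced function $\mathbf{F}_q^n\to\mathbf{F}_q^n$ is bijective. Its finite-extension permutation spectrum is $\mathcal{S}_q(F)=\{m\in\mathbf{N}_{>0}: F\colon\mathbf{F}_{q^m}^n\to\mathbf{F}_{q^m}^n\text{ is bijective}\}$. *)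

theory Defs
  imports
    "HOL-Library.Poly_Mapping"
    "HOL-Library.Cardinality"
    "HOL-Algebra.Algebraic_Closure_Type"
    "Jordan_Normal_Form.Determinant"
begin

text \<open>
  Polynomials in the variables \<open>X\<^sub>0, X\<^sub>1, \<dots>\<close>: a polynomial is a finitely supported map from
  monomials to coefficients, and a monomial is a finitely supported map from variable indices
  to exponents.  The ring structure is the convolution product of Poly_Mapping.  All indices
  are shifted by one: \<open>X\<^sub>0\<close> is the first variable.
\<close>

type_synonym 'a mpoly = "(nat \<Rightarrow>\<^sub>0 nat) \<Rightarrow>\<^sub>0 'a"

definition mconst :: "'a::zero \<Rightarrow> 'a mpoly" where
  "mconst c = Poly_Mapping.single 0 c"

definition mvar :: "nat \<Rightarrow> 'a::zero_neq_one mpoly" where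
  "mvar i = Poly_Mapping.single (Poly_Mapping.single i 1) 1"

definition mvars :: "'a::zero mpoly \<Rightarrow> nat set" where
  "mvars p = (\<Union>m\<in>Poly_Mapping.keys p. Poly_Mapping.keys m)"

text \<open>Evaluation at \<open>x\<close>, the coefficients being mapped into the target ring by \<open>\<iota>\<close>.\<close>

definition meval :: "('a::zero \<Rightarrow> 'b::comm_ring_1) \<Rightarrow> (nat \<Rightarrow> 'b) \<Rightarrow> 'a mpoly \<Rightarrow> 'b" where
  "meval \<iota> x p = (\<Sum>m\<in>Poly_Mapping.keys p. \<iota> (Poly_Mapping.lookup p m) *
     (\<Prod>i\<in>Poly_Mapping.keys m. x i ^ Poly_Mapping.lookup m i))"

text \<open>
  The formal partial derivative.  Subtraction of monomials truncates, but the monomials without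
  \<open>X\<^sub>i\<close> get the coefficient \<open>0\<close>.
\<close>

definition mderiv :: "nat \<Rightarrow> 'a::comm_ring_1 mpoly \<Rightarrow> 'a mpoly" where
  "mderiv i p = (\<Sum>m\<in>Poly_Mapping.keys p. Poly_Mapping.single (m - Poly_Mapping.single i 1)
     (of_nat (Poly_Mapping.lookup m i) * Poly_Mapping.lookup p m))"

definition poly_maps :: "nat \<Rightarrow> 'a::zero mpoly vec set" where
  "poly_maps n = {F \<in> carrier_vec n. \<forall>i<n. mvars (F $ i) \<subseteq> {..<n}}"

definition jacobian :: "nat \<Rightarrow> 'a::comm_ring_1 mpoly vec \<Rightarrow> 'a mpoly mat" where
  "jacobian n F = mat n n (\<lambda>(i, j). mderiv j (F $ i))"

definition keller_map :: "nat \<Rightarrow> 'a::comm_ring_1 mpoly vec \<Rightarrow> bool" where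
  "keller_map n F \<longleftrightarrow> F \<in> poly_maps n \<and> (\<exists>c. c \<noteq> 0 \<and> det (jacobian n F) = mconst c)"

definition induced_map ::
  "('a::zero \<Rightarrow> 'b::comm_ring_1) \<Rightarrow> 'a mpoly vec \<Rightarrow> 'b vec \<Rightarrow> 'b vec" where
  "induced_map \<iota> F x = map_vec (meval \<iota> (\<lambda>i. x $ i)) F"

definition mock_automorphism :: "nat \<Rightarrow> 'a::finite_field mpoly vec \<Rightarrow> bool" where
  "mock_automorphism n F \<longleftrightarrow>
     keller_map n F \<and> bij_betw (induced_map id F) (carrier_vec n) (carrier_vec n)"

text \<open>
  For \<open>'a\<close> with \<open>q\<close> elements, the field with \<open>q\<^sup>m\<close> elements, realised as the set of roots of
  \<open>X\<^bsup>q^m\<^esup> - X\<close> in the algebraic closure of \<open>'a\<close>.  The lemmas below show that this is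
  a subfield with \<open>q\<^sup>m\<close> elements for \<open>m > 0\<close>, and that it contains the image of \<open>'a\<close>.
\<close>

definition ext_field :: "nat \<Rightarrow> 'a::finite_field alg_closure set" where
  "ext_field m = {x. x ^ (CARD('a) ^ m) = x}"

lemma of_nat_card_finite_field: "of_nat CARD('a) = (0 :: 'a::finite_field)"
proof -
  have "(\<Sum>x\<in>(UNIV::'a set). x) = (\<Sum>x\<in>(UNIV::'a set). x + 1)"
    by (rule sum.reindex_bij_witness[of _ "\<lambda>x. x + 1" "\<lambda>x. x - 1"]) auto
  also have "\<dots> = (\<Sum>x\<in>(UNIV::'a set). x) + of_nat CARD('a)"
    by (simp add: sum.distrib)
  finally show ?thesis by simp
qed

lemma card_finite_field_gt_1: "CARD('a::finite_field) > 1"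
proof -
  have "card {0, 1 :: 'a} \<le> CARD('a)" by (intro card_mono) auto
  thus ?thesis by simp
qed

lemma add_power_card:
  fixes x y :: "'a::finite_field alg_closure"
  shows "(x + y) ^ (CARD('a) ^ m) = x ^ (CARD('a) ^ m) + y ^ (CARD('a) ^ m)"
proof -
  define q where "q = CARD('a)"
  have q: "q > 1" using card_finite_field_gt_1[where 'a='a] by (simp add: q_def)
  have ch: "of_nat (q choose k) = (0 :: 'a)" if k: "0 < k" "k < q" for k
  proof -
    define p :: "'a Polynomial.poly" where
      "p = (\<Sum>k\<in>{0<..<q}. Polynomial.monom (of_nat (q choose k)) k)"
    have deg: "Polynomial.degree p < q"
    proof -
      have "Polynomial.degree p \<le> q - 1" unfolding p_def
        by (intro degree_sum_le) (auto intro!: order.trans[OF degree_monom_le])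
      thus ?thesis using q by simp
    qed
    have "poly p x = 0" for x :: 'a
    proof -
      have "(x + 1) ^ q = (\<Sum>k\<le>q. of_nat (q choose k) * x ^ k)"
        by (subst binomial_ring) simp
      also have "{..q} = insert 0 (insert q {0<..<q})" using q by auto
      also have "(\<Sum>k\<in>\<dots>. of_nat (q choose k) * x ^ k) = 1 + x ^ q + poly p x"
        using q by (simp add: p_def poly_sum poly_monom)
      finally show ?thesis
        using finite_field_power_card_eq_same[of x] finite_field_power_card_eq_same[of "x + 1"]
        by (simp add: q_def)
    qed
    hence "card {x. poly p x = 0} = q" by (simp add: q_def)
    hence "p = 0" using card_poly_roots_bound[of p] deg by fastforce
    hence "Polynomial.coeff p k = 0" by simp
    thus ?thesis using k by (simp add: p_def coeff_sum if_distrib cong: if_cong)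
  qed
  have one: "(u + v) ^ q = u ^ q + v ^ q" for u v :: "'a alg_closure"
  proof -
    have "(u + v) ^ q = (\<Sum>k\<le>q. of_nat (q choose k) * u ^ k * v ^ (q - k))"
      by (subst binomial_ring) simp
    also have "\<dots> = (\<Sum>k\<in>{0, q}. of_nat (q choose k) * u ^ k * v ^ (q - k))"
    proof (rule sum.mono_neutral_right)
      show "\<forall>i\<in>{..q} - {0, q}. of_nat (q choose i) * u ^ i * v ^ (q - i) = 0"
      proof
        fix i assume "i \<in> {..q} - {0, q}"
        hence "of_nat (q choose i) = (0 :: 'a)" by (intro ch) auto
        hence "of_nat (q choose i) = (0 :: 'a alg_closure)" by (metis to_ac_0 to_ac_of_nat)
        thus "of_nat (q choose i) * u ^ i * v ^ (q - i) = 0" by simp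
      qed
    qed auto
    also have "\<dots> = u ^ q + v ^ q" using q by (simp add: add.commute)
    finally show ?thesis .
  qed
  have "(x + y) ^ (q ^ m) = x ^ (q ^ m) + y ^ (q ^ m)"
    by (induction m) (simp_all add: power_mult mult.commute[of q] one)
  thus ?thesis by (simp add: q_def)
qed

lemma ext_field_subfield:
  fixes x y :: "'a::finite_field alg_closure"
  shows "(0 :: 'a alg_closure) \<in> ext_field m" "(1 :: 'a alg_closure) \<in> ext_field m"
    and "x \<in> ext_field m \<Longrightarrow> y \<in> ext_field m \<Longrightarrow> x + y \<in> ext_field m"
    and "x \<in> ext_field m \<Longrightarrow> - x \<in> ext_field m"
    and "x \<in> ext_field m \<Longrightarrow> y \<in> ext_field m \<Longrightarrow> x * y \<in> ext_field m"
    and "x \<in> ext_field m \<Longrightarrow> inverse x \<in> ext_field m"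
proof -
  have q: "CARD('a) ^ m > 0" using card_finite_field_gt_1[where 'a='a] by simp
  show "(0 :: 'a alg_closure) \<in> ext_field m" using q by (simp add: ext_field_def)
  show "(1 :: 'a alg_closure) \<in> ext_field m" by (simp add: ext_field_def)
  show "x + y \<in> ext_field m" if "x \<in> ext_field m" "y \<in> ext_field m"
    using that by (simp add: ext_field_def add_power_card)
  show "- x \<in> ext_field m" if "x \<in> ext_field m"
  proof -
    have "0 = x ^ (CARD('a) ^ m) + (- x) ^ (CARD('a) ^ m)"
      using add_power_card[of x "- x" m] q by (simp add: power_0_left)
    thus ?thesis using that by (simp add: ext_field_def eq_neg_iff_add_eq_0 add.commute)
  qed
  show "x * y \<in> ext_field m" if "x \<in> ext_field m" "y \<in> ext_field m"
    using that by (simp add: ext_field_def power_mult_distrib)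
  show "inverse x \<in> ext_field m" if "x \<in> ext_field m"
    using that by (simp add: ext_field_def power_inverse)
qed

lemma to_ac_in_ext_field: "to_ac x \<in> ext_field m"
  using finite_field_power_card_power_eq_same[OF refl, of x m]
  by (simp add: ext_field_def flip: to_ac_power)

lemma card_ext_field:
  assumes "m > 0"
  shows "card (ext_field m :: 'a::finite_field alg_closure set) = CARD('a) ^ m"
proof -
  define N where "N = CARD('a) ^ m"
  have N: "N > 1" unfolding N_def
    using assms card_finite_field_gt_1[where 'a='a] by (intro one_less_power) auto
  have N0: "of_nat N = (0 :: 'a alg_closure)"
    using assms of_nat_card_finite_field[where 'a='a]
    by (metis N_def of_nat_power power_eq_0_iff to_ac_0 to_ac_of_nat)
  define p :: "'a alg_closure Polynomial.poly"
    where "p = Polynomial.monom 1 N - Polynomial.monom 1 1"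
  have deg: "Polynomial.degree p = N"
  proof (rule antisym)
    show "Polynomial.degree p \<le> N"
      unfolding p_def using N
      by (intro degree_diff_le) (auto intro: order.trans[OF degree_monom_le])
    show "N \<le> Polynomial.degree p"
      using N by (intro le_degree) (simp add: p_def)
  qed
  have nz: "p \<noteq> 0" using deg N by auto
  have roots: "{x. poly p x = 0} = ext_field m"
    by (auto simp: p_def ext_field_def poly_monom N_def)
  obtain A where A: "size A = Polynomial.degree p"
      "p = Polynomial.smult (Polynomial.lead_coeff p) (\<Prod>x\<in>#A. [:-x, 1:])"
    using alg_closed_imp_factorization[OF nz] by blast
  have pd: "pderiv p = - 1"
    by (simp add: p_def pderiv_diff pderiv_monom N0 one_pCons Polynomial.monom_0)
  have "count A a \<le> 1" for a
  proof (rule ccontr)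
    assume "\<not> count A a \<le> 1"
    hence "{#a, a#} \<subseteq># A" by (auto simp: subseteq_mset_def)
    then obtain B where "A = {#a, a#} + B" by (metis subset_mset.le_iff_add)
    then obtain r where r: "p = [:-a, 1:] * ([:-a, 1:] * r)"
      using A(2) by (metis (no_types, lifting) add_mset_add_single image_mset_add_mset
        mult_smult_right prod_mset.add_mset union_mset_add_mset_left add_0)
    have "poly (pderiv p) a = 0" by (subst r) (simp add: pderiv_mult del: mult_pCons_left)
    thus False by (simp add: pd)
  qed
  hence "count A a = (if a \<in># A then 1 else 0)" for a
    by (metis One_nat_def count_eq_zero_iff le_SucE le_zero_eq)
  hence "size A = card (set_mset A)"
    by (simp add: size_multiset_overloaded_eq)
  moreover have "set_mset A = {x. poly p x = 0}"
  proof -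
    have "poly p x = 0 \<longleftrightarrow> x \<in># A" for x
      by (subst A(2)) (auto simp: poly_prod_mset prod_mset_zero_iff nz)
    thus ?thesis by auto
  qed
  ultimately show ?thesis using A(1) deg roots by (simp add: N_def)
qed

definition perm_spectrum :: "nat \<Rightarrow> 'a::finite_field mpoly vec \<Rightarrow> nat set" where
  "perm_spectrum n F = {m. m > 0 \<and>
     (let V = {x \<in> carrier_vec n. \<forall>i<n. x $ i \<in> ext_field m}
      in bij_betw (induced_map to_ac F) V V)}"

definition perfect_field :: "'a::field itself \<Rightarrow> bool" where
  "perfect_field _ \<longleftrightarrow> CHAR('a) = 0 \<or> surj (\<lambda>x::'a. x ^ CHAR('a))"

text \<open>
  The map with \<open>q = CARD('a)\<close> and \<open>p = CHAR('a)\<close>; in the shifted indexing its first component is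
  \<open>X\<^sub>0 + (X\<^sub>1 (X\<^sub>0\<^sup>q - X\<^sub>0))\<^bsup>p^e\<^esup>\<close>.
\<close>

definition F_map :: "nat \<Rightarrow> nat \<Rightarrow> 'a::finite_field mpoly vec" where
  "F_map e n = vec n (\<lambda>i.
     if i = 0 then mvar 0 + (mvar 1 * (mvar 0 ^ CARD('a) - mvar 0)) ^ (CHAR('a) ^ e)
     else mvar i)"

end

theory Submission
  imports Defs
begin

text \<open>
  On \<open>L\<^sup>n\<close> the point \<open>(a, y, 0, \<dots>)\<close> has the same image as \<open>(0, y, 0, \<dots>)\<close> as soon as
  \<open>y\<^bsup>p^e\<^esup> (a\<^sup>q - a)\<^bsup>p^e\<^esup> = -a\<close>.  If \<open>a \<notin> F\<^sub>q\<close>, then \<open>a\<^sup>q \<noteq> a\<close>, and such a \<open>y\<close> exists because the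
  Frobenius map of \<open>L\<close> is surjective.  On \<open>F\<^sub>q\<^sup>n\<close> the map is the identity.  Every exponent in a
  \<open>p^e\<close>-th power is divisible by \<open>p\<close>, so its derivatives vanish and the Jacobian matrix is the identity matrix.
\<close>

section \<open>Monomial expansions and evaluation as a ring homomorphism\<close>

lemma poly_mapping_sum_single:
  "p = (\<Sum>m\<in>Poly_Mapping.keys p. Poly_Mapping.single m (Poly_Mapping.lookup p m))"
  by (rule poly_mapping_eqI)
    (auto simp: lookup_sum lookup_single when_def in_keys_iff if_distrib cong: if_cong)

text \<open>The three products run over different key sets. Over the union of the keys of
  \<open>m\<close> and \<open>m'\<close> the additional factors are \<open>x i ^ 0 = 1\<close>, and
  the exponents simply add.\<close>

lemma prod_power_keys_add:
  fixes x :: "'i \<Rightarrow> 'b::comm_monoid_mult" and m m' :: "'i \<Rightarrow>\<^sub>0 nat"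
  shows "(\<Prod>i\<in>Poly_Mapping.keys (m + m'). x i ^ Poly_Mapping.lookup (m + m') i) =
    (\<Prod>i\<in>Poly_Mapping.keys m. x i ^ Poly_Mapping.lookup m i) *
    (\<Prod>i\<in>Poly_Mapping.keys m'. x i ^ Poly_Mapping.lookup m' i)"
proof -
  define A where "A = Poly_Mapping.keys m \<union> Poly_Mapping.keys m'"
  have *: "(\<Prod>i\<in>Poly_Mapping.keys k. x i ^ Poly_Mapping.lookup k i) =
      (\<Prod>i\<in>A. x i ^ Poly_Mapping.lookup k i)"
    if "Poly_Mapping.keys k \<subseteq> A" for k
    using that by (intro prod.mono_neutral_left) (auto simp: A_def in_keys_iff)
  have sub: "Poly_Mapping.keys (m + m') \<subseteq> A" "Poly_Mapping.keys m \<subseteq> A" "Poly_Mapping.keys m' \<subseteq> A"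
    using keys_add[of m m'] by (auto simp: A_def)
  show ?thesis
    unfolding sub[THEN *] by (simp add: lookup_add power_add prod.distrib)
qed

context comm_ring_hom
begin

lemma meval_superset:
  assumes "finite A" "Poly_Mapping.keys p \<subseteq> A"
  shows "meval hom x p = (\<Sum>m\<in>A. hom (Poly_Mapping.lookup p m) *
    (\<Prod>i\<in>Poly_Mapping.keys m. x i ^ Poly_Mapping.lookup m i))"
  unfolding meval_def using assms
  by (intro sum.mono_neutral_left) (auto simp: in_keys_iff)

lemma meval_add: "meval hom x (p + q) = meval hom x p + meval hom x q"
proof -
  let ?A = "Poly_Mapping.keys p \<union> Poly_Mapping.keys q"
  show ?thesis
    using keys_add[of p q]
    by (simp add: meval_superset[where A = ?A] lookup_add hom_add distrib_right sum.distrib)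
qed

lemma meval_sum: "meval hom x (\<Sum>i\<in>A. f i) = (\<Sum>i\<in>A. meval hom x (f i))"
proof (induction A rule: infinite_finite_induct)
  case (insert i A)
  thus ?case by (simp add: meval_add)
qed (auto simp: meval_def)

lemma meval_single:
  "meval hom x (Poly_Mapping.single m c) =
    hom c * (\<Prod>i\<in>Poly_Mapping.keys m. x i ^ Poly_Mapping.lookup m i)"
  by (simp add: meval_superset[where A = "{m}"])

text \<open>Expanding both factors into their terms reduces the claim to products of two monomials,
  for which \<open>prod_power_keys_add\<close> applies.\<close>

lemma meval_mult: "meval hom x (p * q) = meval hom x p * meval hom x q"
proof -
  have "p * q = (\<Sum>m\<in>Poly_Mapping.keys p. \<Sum>k\<in>Poly_Mapping.keys q.
      Poly_Mapping.single (m + k) (Poly_Mapping.lookup p m * Poly_Mapping.lookup q k))"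
    by (subst poly_mapping_sum_single[of p], subst poly_mapping_sum_single[of q])
      (simp add: sum_product mult_single)
  also have "meval hom x \<dots> = meval hom x p * meval hom x q"
    by (simp add: meval_sum meval_single prod_power_keys_add hom_mult)
      (simp add: meval_def sum_product mult_ac)
  finally show ?thesis .
qed

text \<open>Interpreting the homomorphism locale at an evaluation makes its rules for powers and
  differences available when \<open>F_map\<close> is evaluated.\<close>

lemma comm_ring_hom_meval: "comm_ring_hom (meval hom x)"
proof
  show "meval hom x 1 = 1"
    using meval_single[of x 0 1] by simp
  show "meval hom x 0 = 0"
    by (simp add: meval_def)
qed (simp_all add: meval_add meval_mult)

lemma meval_mvar: "meval hom x (mvar i) = x i"
  by (simp add: mvar_def meval_single)

end

section \<open>Bounds on the variables occurring in a polynomial\<close>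

lemma mvars_add: "mvars (p + q) \<subseteq> mvars p \<union> mvars q"
  using keys_add[of p q] by (force simp: mvars_def)

lemma mvars_diff: "mvars (p - q) \<subseteq> mvars p \<union> mvars (q :: 'a::comm_ring_1 mpoly)"
proof -
  have "Poly_Mapping.keys (p - q) \<subseteq> Poly_Mapping.keys p \<union> Poly_Mapping.keys q"
    by (auto simp: in_keys_iff lookup_minus)
  thus ?thesis by (force simp: mvars_def)
qed

lemma mvars_mult: "mvars (p * q) \<subseteq> mvars p \<union> mvars (q :: 'a::comm_ring_1 mpoly)"
proof
  fix i assume "i \<in> mvars (p * q)"
  then obtain m where m: "m \<in> Poly_Mapping.keys (p * q)" "i \<in> Poly_Mapping.keys m"
    by (auto simp: mvars_def)
  then obtain a b where ab: "m = a + b" "a \<in> Poly_Mapping.keys p" "b \<in> Poly_Mapping.keys q"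
    using keys_mult[of p q] by blast
  with m(2) keys_add[of a b] show "i \<in> mvars p \<union> mvars q"
    by (auto simp: mvars_def)
qed

lemma mvars_power: "mvars (p ^ k) \<subseteq> mvars (p :: 'a::comm_ring_1 mpoly)"
proof (induction k)
  case 0
  show ?case by (simp add: mvars_def)
next
  case (Suc k)
  thus ?case using mvars_mult[of p "p ^ k"] by auto
qed

lemma mvars_mvar: "mvars (mvar i :: 'a::comm_ring_1 mpoly) = {i}"
  by (simp add: mvars_def mvar_def)

section \<open>Formal derivatives in prime characteristic and the Keller condition\<close>

lemma mderiv_add: "mderiv i (p + q) = mderiv i p + mderiv i q"
proof -
  define A where "A = Poly_Mapping.keys p \<union> Poly_Mapping.keys q"
  have *: "mderiv i r = (\<Sum>m\<in>A. Poly_Mapping.single (m - Poly_Mapping.single i 1)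
     (of_nat (Poly_Mapping.lookup m i) * Poly_Mapping.lookup r m))"
    if "Poly_Mapping.keys r \<subseteq> A" for r
    unfolding mderiv_def using that
    by (intro sum.mono_neutral_left) (auto simp: A_def in_keys_iff)
  have "Poly_Mapping.keys (p + q) \<subseteq> A" "Poly_Mapping.keys p \<subseteq> A" "Poly_Mapping.keys q \<subseteq> A"
    using keys_add[of p q] by (auto simp: A_def)
  thus ?thesis
    by (simp add: * lookup_add distrib_left single_add sum.distrib)
qed

lemma mderiv_mvar: "mderiv j (mvar i :: 'a::comm_ring_1 mpoly) = (if i = j then 1 else 0)"
  by (simp add: mderiv_def mvar_def lookup_single)

text \<open>The constant coefficient of \<open>of_nat k\<close> is the image of \<open>k\<close> in
  \<open>'a\<close>. The equality makes the freshman's dream in the polynomial ring available with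
  exponent \<open>CHAR('a)\<close>.\<close>

lemma CHAR_mpoly: "CHAR('a::comm_ring_1 mpoly) = CHAR('a)"
proof (rule CHAR_eqI)
  show "of_nat CHAR('a) = (0 :: 'a mpoly)"
    by (simp flip: single_of_nat)
  show "CHAR('a) dvd k" if "of_nat k = (0 :: 'a mpoly)" for k
  proof -
    have "Poly_Mapping.lookup (of_nat k :: 'a mpoly) 0 = 0" using that by simp
    thus ?thesis by (simp add: lookup_of_nat of_nat_eq_0_iff_char_dvd)
  qed
qed

lemma keys_single_power:
  fixes c :: "'a::comm_ring_1" and m :: "nat \<Rightarrow>\<^sub>0 nat"
  assumes "m' \<in> Poly_Mapping.keys (Poly_Mapping.single m c ^ k)"
  shows "Poly_Mapping.lookup m' i = k * Poly_Mapping.lookup m i"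
  using assms
proof (induction k arbitrary: m')
  case (Suc k)
  then obtain a b where "m' = a + b" "a \<in> Poly_Mapping.keys (Poly_Mapping.single m c)"
      "b \<in> Poly_Mapping.keys (Poly_Mapping.single m c ^ k)"
    using keys_mult[of "Poly_Mapping.single m c" "Poly_Mapping.single m c ^ k"] by auto
  with Suc.IH show ?case by (auto simp: lookup_add split: if_splits)
qed auto

text \<open>By the freshman's dream the power of the sum is the sum of the powers of its terms, and
  raising a single term to a power multiplies all its exponents by
  \<open>CHAR('a) ^ e\<close>.\<close>

lemma CHAR_dvd_lookup_keys_power:
  fixes p :: "'a::comm_ring_1 mpoly"
  assumes "prime CHAR('a)" "e \<ge> 1" "m \<in> Poly_Mapping.keys (p ^ (CHAR('a) ^ e))"
  shows "CHAR('a) dvd Poly_Mapping.lookup m i"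
proof -
  have "p ^ (CHAR('a) ^ e) = (\<Sum>k\<in>Poly_Mapping.keys p.
      Poly_Mapping.single k (Poly_Mapping.lookup p k) ^ (CHAR('a) ^ e))"
    by (subst poly_mapping_sum_single[of p], rule freshmans_dream_sum')
      (use assms(1) in \<open>simp_all add: CHAR_mpoly\<close>)
  with assms(3) obtain k where
    "m \<in> Poly_Mapping.keys (Poly_Mapping.single k (Poly_Mapping.lookup p k) ^ (CHAR('a) ^ e))"
    using keys_sum by fastforce
  hence "Poly_Mapping.lookup m i = CHAR('a) ^ e * Poly_Mapping.lookup k i"
    by (rule keys_single_power)
  thus ?thesis using assms(2) by (simp add: dvd_power)
qed

lemma mderiv_power_CHAR_power:
  fixes p :: "'a::comm_ring_1 mpoly"
  assumes "prime CHAR('a)" "e \<ge> 1"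
  shows "mderiv i (p ^ (CHAR('a) ^ e)) = 0"
proof -
  have "of_nat (Poly_Mapping.lookup m i) = (0 :: 'a)"
    if "m \<in> Poly_Mapping.keys (p ^ (CHAR('a) ^ e))" for m
    using CHAR_dvd_lookup_keys_power[OF assms that] by (simp add: of_nat_eq_0_iff_char_dvd)
  thus ?thesis by (simp add: mderiv_def)
qed

lemma prime_CHAR_finite_field: "prime CHAR('a::finite_field)"
  by (simp add: prime_CHAR_semidom)

lemma keller_map_F_map:
  assumes "e \<ge> 1" "n \<ge> 2"
  shows "keller_map n (F_map e n :: 'a::finite_field mpoly vec)"
proof -
  have "mvars (mvar 0 + (mvar 1 * (mvar 0 ^ CARD('a) - mvar 0)) ^ (CHAR('a) ^ e) :: 'a mpoly)
      \<subseteq> {0, 1}"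
    by (intro order.trans[OF mvars_add] order.trans[OF mvars_power] order.trans[OF mvars_mult]
        order.trans[OF mvars_diff] Un_least) (simp_all add: mvars_mvar)
  hence poly: "(F_map e n :: 'a mpoly vec) \<in> poly_maps n"
    using assms(2) by (auto simp: poly_maps_def F_map_def mvars_mvar)
  have "jacobian n (F_map e n :: 'a mpoly vec) = 1\<^sub>m n"
    using assms(1)
    by (intro eq_matI)
      (auto simp: jacobian_def F_map_def mderiv_add mderiv_mvar mderiv_power_CHAR_power
        prime_CHAR_finite_field)
  hence "det (jacobian n (F_map e n :: 'a mpoly vec)) = mconst 1"
    by (simp add: mconst_def)
  with poly show ?thesis
    unfolding keller_map_def by (metis one_neq_zero)
qed

section \<open>The induced map: identity on fixed points of the q-th power, collisions
  elsewhere\<close>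

lemma induced_map_F_map:
  fixes \<iota> :: "'a::finite_field \<Rightarrow> 'b::comm_ring_1"
  assumes "comm_ring_hom \<iota>"
  shows "induced_map \<iota> (F_map e n) x = vec n (\<lambda>i.
    if i = 0 then x $ 0 + (x $ 1 * ((x $ 0) ^ CARD('a) - x $ 0)) ^ (CHAR('a) ^ e) else x $ i)"
proof -
  interpret \<iota>: comm_ring_hom \<iota> by fact
  interpret ev: comm_ring_hom "meval \<iota> (\<lambda>i. x $ i)" by (rule \<iota>.comm_ring_hom_meval)
  show ?thesis
    by (intro eq_vecI)
      (auto simp: induced_map_def F_map_def \<iota>.meval_mvar ev.hom_add ev.hom_mult ev.hom_power
        ev.hom_minus)
qed

text \<open>The bracket \<open>x^q - x\<close> vanishes on \<open>S\<close>, so the map is the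
  identity there. The set \<open>S\<close> will be either the whole of \<open>'a\<close> or its copy
  \<open>ext_field 1\<close> in the algebraic closure.\<close>

lemma bij_betw_induced_map_F_map:
  fixes \<iota> :: "'a::finite_field \<Rightarrow> 'b::comm_ring_1"
  assumes "comm_ring_hom \<iota>" "n \<ge> 2" and S: "\<And>x. x \<in> S \<Longrightarrow> x ^ CARD('a) = x"
  defines "V \<equiv> {x \<in> carrier_vec n. \<forall>i<n. x $ i \<in> S}"
  shows "bij_betw (induced_map \<iota> (F_map e n)) V V"
proof -
  have "induced_map \<iota> (F_map e n) x = x" if "x \<in> V" for x
    using that assms(2) S[of "x $ 0"] prime_gt_0_nat[OF prime_CHAR_finite_field[where 'a = 'a]]
    by (auto simp: induced_map_F_map[OF assms(1)] V_def power_0_left)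
  hence "bij_betw (induced_map \<iota> (F_map e n)) V V \<longleftrightarrow> bij_betw id V V"
    by (intro bij_betw_cong) simp
  thus ?thesis by simp
qed

text \<open>The set \<open>S\<close> allows one argument for both the finite fields
  \<open>ext_field m\<close> and a whole field \<open>'b\<close>. The value of
  \<open>y ^ (CHAR('a) ^ e)\<close> is chosen so that the first coordinate of the image of
  \<open>u a\<close> becomes \<open>0\<close>, as it is for \<open>u 0\<close>.\<close>

lemma not_inj_on_induced_map_F_map:
  fixes \<iota> :: "'a::finite_field \<Rightarrow> 'b::field"
  assumes "comm_ring_hom \<iota>" "n \<ge> 2" "0 \<in> S" "a \<in> S" "y \<in> S" "a ^ CARD('a) \<noteq> a"
    and y: "y ^ (CHAR('a) ^ e) = - a / (a ^ CARD('a) - a) ^ (CHAR('a) ^ e)"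
  shows "\<not> inj_on (induced_map \<iota> (F_map e n)) {x \<in> carrier_vec n. \<forall>i<n. x $ i \<in> S}"
proof
  define u :: "'b \<Rightarrow> 'b vec" where
    "u b = vec n (\<lambda>i. if i = 0 then b else if i = 1 then y else 0)" for b
  have P: "CHAR('a) ^ e > 0"
    using prime_gt_0_nat[OF prime_CHAR_finite_field[where 'a = 'a]] by simp
  have a: "a \<noteq> 0"
    using assms(6) card_finite_field_gt_1[where 'a = 'a] by (auto simp: power_0_left)
  have "a + (y * (a ^ CARD('a) - a)) ^ (CHAR('a) ^ e) = 0"
    using assms(6) by (simp add: power_mult_distrib y)
  hence eq: "induced_map \<iota> (F_map e n) (u a) = induced_map \<iota> (F_map e n) (u 0)"
    using assms(2) P card_finite_field_gt_1[where 'a = 'a]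
    by (auto simp: induced_map_F_map[OF assms(1)] u_def power_0_left)
  assume inj: "inj_on (induced_map \<iota> (F_map e n)) {x \<in> carrier_vec n. \<forall>i<n. x $ i \<in> S}"
  have "u a = u 0"
    using assms(3-5) by (intro inj_onD[OF inj eq]) (auto simp: u_def)
  hence "u a $ 0 = u 0 $ 0" by simp
  with a assms(2) show False by (simp add: u_def)
qed

section \<open>Frobenius powers and the roots of \<open>X^q - X\<close>\<close>

lemma inj_frobenius_power:
  fixes x y :: "'b::field"
  assumes "prime CHAR('b)" "x ^ (CHAR('b) ^ e) = y ^ (CHAR('b) ^ e)"
  shows "x = y"
proof -
  \<comment> \<open>The freshman's dream for \<open>x = (x - y) + y\<close> forces the power of
    \<open>x - y\<close> to be \<open>0\<close>, and a field has no nonzero nilpotents.\<close>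
  have "x ^ (CHAR('b) ^ e) = (x - y) ^ (CHAR('b) ^ e) + y ^ (CHAR('b) ^ e)"
    using freshmans_dream'[OF assms(1) refl, of "x - y" y e] by simp
  with assms(2) show ?thesis by simp
qed

lemma surj_power_power:
  assumes "surj (\<lambda>x::'b::monoid_mult. x ^ p)"
  shows "surj (\<lambda>x::'b. x ^ (p ^ e))"
proof (induction e)
  case (Suc e)
  have "surj ((\<lambda>x::'b. x ^ (p ^ e)) \<circ> (\<lambda>x. x ^ p))"
    using Suc assms by (rule comp_surj[rotated])
  thus ?case by (simp add: comp_def flip: power_mult)
qed simp

text \<open>A field homomorphism is injective, so \<open>of_nat k\<close> vanishes in both fields or
  in neither. This links the exponent in \<open>F_map\<close>, taken from the base field, to
  perfectness of the target.\<close>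

lemma (in field_hom) CHAR_eq: "CHAR('b) = CHAR('a)"
proof (rule CHAR_eqI)
  have *: "hom (of_nat k) = of_nat k" for k
    by (induction k) (simp_all add: hom_add)
  show "of_nat CHAR('a) = (0 :: 'b)"
    using *[of "CHAR('a)"] by simp
  show "CHAR('a) dvd k" if "of_nat k = (0 :: 'b)" for k
    using *[of k] that by (simp add: of_nat_eq_0_iff_char_dvd)
qed

text \<open>The polynomial \<open>X^q - X\<close> has at most \<open>q\<close> roots in the target,
  and the image of \<open>hom\<close> already supplies \<open>q\<close> of them. In this locale
  \<open>'a\<close> is an arbitrary field, so the finite field facts appear as hypotheses.\<close>

lemma (in field_hom) range_if_power_CARD_eq_same:
  assumes "finite (UNIV :: 'a set)" and "CARD('a) > 1"
  assumes "\<And>x::'a. x ^ CARD('a) = x" and "a ^ CARD('a) = a"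
  shows "a \<in> range hom"
proof (rule ccontr)
  assume a: "a \<notin> range hom"
  define f :: "'b Polynomial.poly" where
    "f = Polynomial.monom 1 CARD('a) - Polynomial.monom 1 1"
  have "Polynomial.coeff f CARD('a) = 1" using assms(2) by (simp add: f_def)
  hence f: "f \<noteq> 0" by auto
  have "Polynomial.degree f \<le> CARD('a)"
    unfolding f_def using assms(2)
    by (intro degree_diff_le) (auto intro: order.trans[OF degree_monom_le])
  moreover have "insert a (range hom) \<subseteq> {x. poly f x = 0}"
    using assms(3,4) by (auto simp: f_def poly_monom simp flip: hom_power)
  hence "card (insert a (range hom)) \<le> card {x. poly f x = 0}"
    by (rule card_mono[OF poly_roots_finite[OF f]])
  moreover have "card (range hom) = CARD('a)"
    by (rule card_image) (simp add: inj_on_def)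
  ultimately show False
    using a assms(1) card_poly_roots_bound[OF f] by simp
qed

text \<open>The power map is an injective self-map of a finite set, hence surjective.\<close>

lemma ext_field_power_surj:
  fixes c :: "'a::finite_field alg_closure"
  assumes "m > 0" "c \<in> ext_field m"
  obtains y where "y \<in> ext_field m" "y ^ (CHAR('a) ^ e) = c"
proof -
  let ?f = "\<lambda>x :: 'a alg_closure. x ^ (CHAR('a) ^ e)"
  have "finite (ext_field m :: 'a alg_closure set)"
    using card_ext_field[OF assms(1), where 'a = 'a] card_finite_field_gt_1[where 'a = 'a]
    by (intro card_ge_0_finite) simp
  moreover have "?f ` ext_field m \<subseteq> ext_field m"
    by (auto simp: ext_field_def simp flip: power_mult) (metis mult.commute power_mult)
  moreover have "inj_on ?f (ext_field m)"
    using inj_frobenius_power[where 'b = "'a alg_closure"] prime_CHAR_finite_field[where 'a = 'a]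
    by (auto intro!: inj_onI)
  ultimately have "?f ` ext_field m = ext_field m" by (rule endo_inj_surj)
  with assms(2) have "c \<in> ?f ` ext_field m" by (simp only:)
  then obtain y where "c = ?f y" "y \<in> ext_field m" by (rule imageE)
  thus ?thesis by (intro that) simp_all
qed

section \<open>The permutation spectrum and the main result\<close>

lemma perm_spectrum_F_map:
  assumes "n \<ge> 2"
  shows "perm_spectrum n (F_map e n :: 'a::finite_field mpoly vec) = {1}"
proof -
  have hom: "comm_ring_hom (to_ac :: 'a \<Rightarrow> _)" by standard auto
  have "m = 1" if m: "m > 0" and bij: "bij_betw (induced_map to_ac (F_map e n))
      {x \<in> carrier_vec n. \<forall>i<n. x $ i \<in> ext_field m}
      {x \<in> carrier_vec n. \<forall>i<n. x $ i \<in> (ext_field m :: 'a alg_closure set)}" for m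
  proof (rule ccontr)
    let ?E = "ext_field :: nat \<Rightarrow> 'a alg_closure set"
    assume "m \<noteq> 1"
    \<comment> \<open>Counting alone gives a point of \<open>?E m\<close> outside
      \<open>?E 1\<close>. By definition of \<open>ext_field 1\<close> such a point satisfies
      \<open>a^q \<noteq> a\<close>.\<close>
    with m have "CARD('a) ^ 1 < CARD('a) ^ m"
      using card_finite_field_gt_1[where 'a = 'a] by (intro power_strict_increasing) auto
    hence "card (?E 1) < card (?E m)"
      using m by (simp add: card_ext_field)
    moreover have "finite (?E 1)"
      using card_ext_field[of 1, where 'a = 'a] by (intro card_ge_0_finite) simp
    ultimately obtain a where a: "a \<in> ?E m" "a \<notin> ?E 1"
      by (meson card_mono linorder_not_less subsetI)
    have pow: "x \<in> ?E m \<Longrightarrow> x ^ k \<in> ?E m" for x k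
      by (induction k) (auto simp: ext_field_subfield)
    have diff: "a ^ CARD('a) - a \<in> ?E m"
      using ext_field_subfield(3,4)[where 'a = 'a] pow[OF a(1)] a(1)
      by (metis diff_conv_add_uminus)
    \<comment> \<open>The root \<open>y\<close> must itself lie in \<open>?E m\<close> for the
      collision to take place there; it suffices that the element whose root is taken does.\<close>
    have "- a / (a ^ CARD('a) - a) ^ (CHAR('a) ^ e) \<in> ?E m"
      unfolding divide_inverse
      by (intro ext_field_subfield(4-6) pow a(1) diff)
    then obtain y where "y \<in> ?E m"
        "y ^ (CHAR('a) ^ e) = - a / (a ^ CARD('a) - a) ^ (CHAR('a) ^ e)"
      by (rule ext_field_power_surj[OF m])
    hence "\<not> inj_on (induced_map to_ac (F_map e n)) {x \<in> carrier_vec n. \<forall>i<n. x $ i \<in> ?E m}"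
      using a by (intro not_inj_on_induced_map_F_map[OF hom assms])
        (auto simp: ext_field_subfield ext_field_def)
    with bij show False by (simp add: bij_betw_def)
  qed
  moreover have "bij_betw (induced_map to_ac (F_map e n))
      {x \<in> carrier_vec n. \<forall>i<n. x $ i \<in> ext_field 1}
      {x \<in> carrier_vec n. \<forall>i<n. x $ i \<in> (ext_field 1 :: 'a alg_closure set)}"
    by (rule bij_betw_induced_map_F_map[OF hom assms]) (simp add: ext_field_def)
  ultimately show ?thesis
    by (auto simp: perm_spectrum_def Let_def)
qed

theorem corollary4p5:
  fixes e n :: nat
  assumes "e \<ge> 1" and "n \<ge> 2"
  shows "mock_automorphism n (F_map e n :: 'a::finite_field mpoly vec) \<and>
    perm_spectrum n (F_map e n :: 'a mpoly vec) = {1} \<and>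
    (\<forall>\<iota> :: 'a \<Rightarrow> 'b::field.
       perfect_field TYPE('b) \<and> field_hom \<iota> \<and> range \<iota> \<noteq> UNIV \<longrightarrow>
       \<not> inj_on (induced_map \<iota> (F_map e n :: 'a mpoly vec)) (carrier_vec n))"
proof (intro conjI allI impI)
  have "comm_ring_hom (id :: 'a \<Rightarrow> 'a)" by standard auto
  from bij_betw_induced_map_F_map[OF this assms(2) finite_field_power_card_eq_same, where S = UNIV]
  have "bij_betw (induced_map id (F_map e n :: 'a mpoly vec)) (carrier_vec n) (carrier_vec n)"
    by simp
  with keller_map_F_map[OF assms] show "mock_automorphism n (F_map e n :: 'a mpoly vec)"
    by (simp only: mock_automorphism_def)
  show "perm_spectrum n (F_map e n :: 'a mpoly vec) = {1}"
    by (rule perm_spectrum_F_map[OF assms(2)])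
next
  fix \<iota> :: "'a \<Rightarrow> 'b"
  assume *: "perfect_field TYPE('b) \<and> field_hom \<iota> \<and> range \<iota> \<noteq> UNIV"
  then interpret field_hom \<iota> by simp
  obtain a where "a \<notin> range \<iota>" using * by blast
  hence a: "a ^ CARD('a) \<noteq> a"
    using range_if_power_CARD_eq_same card_finite_field_gt_1[where 'a = 'a]
    by (auto simp: finite_field_power_card_eq_same)
  \<comment> \<open>Since the common characteristic is positive, perfectness of \<open>'b\<close>
    means surjectivity of its Frobenius map.\<close>
  have "surj (\<lambda>x::'b. x ^ CHAR('a))"
    using * CHAR_eq prime_gt_0_nat[OF prime_CHAR_finite_field[where 'a = 'a]]
    by (simp add: perfect_field_def)
  hence "surj (\<lambda>x::'b. x ^ (CHAR('a) ^ e))"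
    by (rule surj_power_power)
  then obtain y where "- a / (a ^ CARD('a) - a) ^ (CHAR('a) ^ e) = y ^ (CHAR('a) ^ e)"
    by (rule surjE)
  with a show "\<not> inj_on (induced_map \<iota> (F_map e n)) (carrier_vec n)"
    using not_inj_on_induced_map_F_map[OF comm_ring_hom_axioms assms(2), of UNIV a y e] by simp
qed

end
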